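(* Let $G$ be a connected graph. If $c_2$ is topologically simple, i.e. $\gamma(\mathcal K_{c_2})=1$, then $S(\vec\phi)\le 2$ for every $\vec\phi\in\mathcal K_{c_2}$; that is, $\nu(c_2,G)\le2$.
   Context: $G=(V,E)$ is a finite simple undirected connected graph, $V=\{1,\dots,n\}$, $n\ge 2$; $d_i$ is the degree of $i$. $\mathrm{Sgn}(t)=\{1\}$ if $t>0$, $\{-1\}$ if $t<0$, $[-1,1]$ if $t=0$. $I(\vec x)=\sum_{\{i,j\}\in E}|x_i-x_j|$ and $X=\{\vec x\in\mathbb R^n:\sum_i d_i|x_i|=1\}$. A nonzero $\vec x\in\mathbb R^n$ is an eigenvector of the $1$-Laplacian with eigenvalue $\mu$ if there exist $z_{ij}\in\mathrm{Sgn}(x_i-x_j)$ with $z_{ji}=-z_{ij}$ (for all adjacent $i,j$) such that $\sum_{j\sim i}z_{ij}\in\mu d_i\,\mathrm{Sgn}(x_i)$ for all $i\in V$. $\mathcal K_\mu$ is the set of eigenvectors in $X$ with eigenvalue $\mu$. $\gamma(A)$, for closed $A=-A\subset\mathbb R^n\setminus\{0\}$, is the Krasnoselskii genus: the least integer $m\ge0$ for which there is an odd continuous map $A\to\mathbb R^m\setminus\{0\}$. $c_k=\inf_{\gamma(A)\ge k}\max_{\vec x\in A}I(\vec x)$, the infimum over closed $A=-A\subset X$. Each $c_k$ is an eigenvalue, and $c_{k+1}=\dots=c_{k+l}=c$ implies $\gamma(\mathcal K_c)\ge l$ (known Liusternik–Schnirelmann multiplicity theorem). The (strong) nodal domains of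 $\vec x$ are the vertex sets of the connected components of the subgraphs induced on $\{i:x_i>0\}$ and on $\{i:x_i<0\}$; $S(\vec x)$ is the total number of them; $\nu(\mu,G)=\max_{\vec\phi\in\mathcal K_\mu}S(\vec\phi)$. *)

theory Defs
  imports "HOL-Analysis.Analysis"
begin

(* A finite simple graph on the vertex type 'n is given by its adjacency relation E,
   a symmetric irreflexive relation; every edge {i,j} is present as (i,j) and (j,i). *)

definition degree :: "('n::finite \<times> 'n) set \<Rightarrow> 'n \<Rightarrow> nat" where
  "degree E i = card (E `` {i})"

definition connected_graph :: "('n::finite \<times> 'n) set \<Rightarrow> bool" where
  "connected_graph E \<longleftrightarrow> (\<forall>i j. (i, j) \<in> E\<^sup>*)"

definition Sgn :: "real \<Rightarrow> real set" where
  "Sgn t = (if t > 0 then {1} else if t < 0 then {-1} else {-1..1})"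

(* The factor 1/2 compensates for each edge occurring in both orientations. *)
definition total_variation :: "('n::finite \<times> 'n) set \<Rightarrow> real ^ 'n \<Rightarrow> real" where
  "total_variation E x = (\<Sum>(i, j)\<in>E. \<bar>x $ i - x $ j\<bar>) / 2"

definition unit_set :: "('n::finite \<times> 'n) set \<Rightarrow> (real ^ 'n) set" where
  "unit_set E = {x. (\<Sum>i\<in>UNIV. real (degree E i) * \<bar>x $ i\<bar>) = 1}"

definition is_eigenvector :: "('n::finite \<times> 'n) set \<Rightarrow> real \<Rightarrow> real ^ 'n \<Rightarrow> bool" where
  "is_eigenvector E \<mu> x \<longleftrightarrow> x \<noteq> 0 \<and>
     (\<exists>z :: 'n \<Rightarrow> 'n \<Rightarrow> real.
        (\<forall>(i, j)\<in>E. z i j \<in> Sgn (x $ i - x $ j) \<and> z j i = - z i j) \<and>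
        (\<forall>i. (\<Sum>j\<in>E `` {i}. z i j) \<in> (\<lambda>s. \<mu> * real (degree E i) * s) ` Sgn (x $ i)))"

definition eigenset :: "('n::finite \<times> 'n) set \<Rightarrow> real \<Rightarrow> (real ^ 'n) set" where
  "eigenset E \<mu> = {x \<in> unit_set E. is_eigenvector E \<mu> x}"

(* The codomain R^m minus the origin has its dimension m varying inside the formula, hence
   the library's Euclidean_space m (sequences vanishing from index m on). *)
definition odd_map_to_punctured :: "'a::real_normed_vector set \<Rightarrow> nat \<Rightarrow> ('a \<Rightarrow> nat \<Rightarrow> real) \<Rightarrow> bool" where
  "odd_map_to_punctured A m f \<longleftrightarrow>
     continuous_map (top_of_set A)
       (subtopology (Euclidean_space m) (topspace (Euclidean_space m) - {\<lambda>i. 0})) f \<and>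
     (\<forall>x\<in>A. \<forall>i. f (- x) i = - f x i)"

(* Meant for closed A = -A not containing 0. In a finite-dimensional space the inclusion of A
   is an odd map as required, so the least m exists; the genus is 0 exactly for the empty set. *)
definition genus :: "'a::euclidean_space set \<Rightarrow> nat" where
  "genus A = (LEAST m. \<exists>f. odd_map_to_punctured A m f)"

(* For k \<ge> 1 every admissible A is nonempty and, if all degrees are positive, compact, so the
   inner supremum is a maximum. *)
definition minimax_value :: "('n::finite \<times> 'n) set \<Rightarrow> nat \<Rightarrow> real" where
  "minimax_value E k =
     (INF A\<in>{A. closed A \<and> uminus ` A = A \<and> A \<subseteq> unit_set E \<and> k \<le> genus A}.
        SUP x\<in>A. total_variation E x)"

(* The vertex sets of the connected components of the subgraph induced on U. *)
definition components_on :: "('n::finite \<times> 'n) set \<Rightarrow> 'n set \<Rightarrow> 'n set set" where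
  "components_on E U = U // (Restr E U)\<^sup>*"

definition nodal_domains :: "('n::finite \<times> 'n) set \<Rightarrow> real ^ 'n \<Rightarrow> 'n set set" where
  "nodal_domains E x = components_on E {i. x $ i > 0} \<union> components_on E {i. x $ i < 0}"

definition nodal_count :: "('n::finite \<times> 'n) set \<Rightarrow> real ^ 'n \<Rightarrow> nat" where
  "nodal_count E x = card (nodal_domains E x)"

definition max_nodal_count :: "('n::finite \<times> 'n) set \<Rightarrow> real \<Rightarrow> nat" where
  "max_nodal_count E \<mu> = Max (nodal_count E ` eigenset E \<mu>)"

end

theory Submission imports Defs begin

text \<open>Write \<open>\<mu>\<close> for \<open>c\<^sub>2\<close> and \<open>vol\<close> for the sum of the degrees. For every proper nonempty \<open>A\<close> the
  circle spanned by the indicators of \<open>A\<close> and its complement has genus at least 2, because it is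
  connected and symmetric; this bounds \<open>\<mu> min(vol A, vol A\<^sup>c)\<close> by the cut of \<open>A\<close>. By the layer-cake
  formula and convex duality, every vector with weighted median 0 whose total variation is at most
  \<open>\<mu>\<close> times its weighted norm is then an eigenvector for \<open>\<mu>\<close>. The indicator of a nodal domain
  \<open>D\<close> of an eigenvector satisfies this with equality, and \<open>vol D\<close> is at most half the total
  volume. Given three nodal domains with normalised indicators
  \<open>e\<^sub>1, e\<^sub>2, e\<^sub>3\<close>, each segment from \<open>e\<^sub>i\<close> to \<open>- e\<^sub>j\<close> with \<open>i \<noteq> j\<close> still has median 0 and hence
  consists of eigenvectors. The path \<open>e\<^sub>1, - e\<^sub>2, e\<^sub>3, - e\<^sub>1\<close> joins antipodal points inside the
  eigenset, so an odd map into the punctured line is excluded by the intermediate value theorem.\<close>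

section \<open>Divergence and volume\<close>

text \<open>The net outflow of the edge flow \<open>z\<close> at each vertex, that is, the left-hand
  sides of the eigenvector equations collected into one vector.\<close>

definition divergence :: "('n::finite \<times> 'n) set \<Rightarrow> ('n \<Rightarrow> 'n \<Rightarrow> real) \<Rightarrow> real ^ 'n" where
  "divergence E z = (\<chi> i. \<Sum>j\<in>E `` {i}. z i j)"

definition volume :: "('n::finite \<times> 'n) set \<Rightarrow> 'n set \<Rightarrow> real" where
  "volume E A = (\<Sum>i\<in>A. real (degree E i))"

definition weighted_norm :: "('n::finite \<times> 'n) set \<Rightarrow> real ^ 'n \<Rightarrow> real" where
  "weighted_norm E x = (\<Sum>i\<in>UNIV. real (degree E i) * \<bar>x $ i\<bar>)"

definition ind_vec :: "'n set \<Rightarrow> real ^ 'n::finite" where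
  "ind_vec A = (\<chi> i. indicator A i)"

lemma ind_vec_nth [simp]: "ind_vec A $ i = indicator A i"
  by (simp add: ind_vec_def)

lemma unit_set_iff: "x \<in> unit_set E \<longleftrightarrow> weighted_norm E x = 1"
  by (simp add: unit_set_def weighted_norm_def)

lemma sum_edges:
  fixes E :: "('n::finite \<times> 'n) set"
  shows "(\<Sum>i\<in>UNIV. \<Sum>j\<in>E `` {i}. f i j) = (\<Sum>(i, j)\<in>E. f i j :: real)"
proof -
  have "Sigma UNIV (\<lambda>i. E `` {i}) = E" by auto
  then show ?thesis by (simp add: sum.Sigma)
qed

lemma sum_edges_swap:
  assumes "sym E"
  shows "(\<Sum>(i, j)\<in>E. f i j :: real) = (\<Sum>(i, j)\<in>E. f j i)"
  by (rule sum.reindex_bij_witness[of _ prod.swap prod.swap]) (use assms in \<open>auto dest: symD\<close>)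

text \<open>Summation by parts: averaging the sum with its copy over reversed edges turns vertex
  values into differences. The factor 1/2 appears because \<open>E\<close> contains both
  orientations of each edge.\<close>

lemma inner_divergence:
  fixes E :: "('n::finite \<times> 'n) set"
  assumes "sym E" and anti: "\<And>i j. (i, j) \<in> E \<Longrightarrow> z j i = - z i j"
  shows "x \<bullet> divergence E z = (\<Sum>(i, j)\<in>E. (x $ i - x $ j) * z i j) / 2"
proof -
  have 1: "x \<bullet> divergence E z = (\<Sum>(i, j)\<in>E. x $ i * z i j)"
    by (simp add: inner_vec_def divergence_def sum_distrib_left flip: sum_edges)
  have "(\<Sum>(i, j)\<in>E. x $ i * z i j) = (\<Sum>(i, j)\<in>E. x $ j * z j i)"
    by (rule sum_edges_swap[OF assms(1)])
  also have "\<dots> = (\<Sum>(i, j)\<in>E. - (x $ j * z i j))"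
    by (rule sum.cong) (auto simp: anti)
  finally have 2: "(\<Sum>(i, j)\<in>E. x $ i * z i j) = (\<Sum>(i, j)\<in>E. - (x $ j * z i j))" .
  have "(\<Sum>(i, j)\<in>E. (x $ i - x $ j) * z i j)
      = (\<Sum>(i, j)\<in>E. x $ i * z i j) + (\<Sum>(i, j)\<in>E. - (x $ j * z i j))"
    by (simp add: sum.distrib[symmetric] case_prod_unfold algebra_simps)
  then show ?thesis using 1 2 by simp
qed

section \<open>Total variation as a seminorm\<close>

lemma total_variation_nonneg: "total_variation E x \<ge> 0"
  unfolding total_variation_def by (auto intro!: sum_nonneg)

lemma total_variation_scaleR: "total_variation E (c *\<^sub>R x) = \<bar>c\<bar> * total_variation E x"
proof -
  have "\<bar>c * x $ i - c * x $ j\<bar> = \<bar>c\<bar> * \<bar>x $ i - x $ j\<bar>" for i j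
    by (simp add: abs_mult[symmetric] right_diff_distrib)
  then show ?thesis
    by (simp add: total_variation_def sum_distrib_left case_prod_unfold)
qed

lemma total_variation_add_le:
  "total_variation E (x + y) \<le> total_variation E x + total_variation E y"
proof -
  have "(\<Sum>(i, j)\<in>E. \<bar>(x + y) $ i - (x + y) $ j\<bar>)
      \<le> (\<Sum>(i, j)\<in>E. \<bar>x $ i - x $ j\<bar> + \<bar>y $ i - y $ j\<bar>)"
    by (rule sum_mono) auto
  also have "\<dots> = (\<Sum>(i, j)\<in>E. \<bar>x $ i - x $ j\<bar>) + (\<Sum>(i, j)\<in>E. \<bar>y $ i - y $ j\<bar>)"
    by (simp add: sum.distrib case_prod_unfold)
  finally show ?thesis by (simp add: total_variation_def)
qed

lemma total_variation_compl: "total_variation E (ind_vec (- A)) = total_variation E (ind_vec A)"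
  unfolding total_variation_def
  by (intro arg_cong[where f = "\<lambda>t. t / 2"] sum.cong) (auto simp: indicator_def)

text \<open>The triangle inequality on each edge charges a vertex once per incident edge. On
  \<open>unit_set E\<close> this bounds the total variation by 1, which makes the suprema in
  \<open>minimax_value\<close> finite.\<close>

lemma total_variation_le_weighted_norm:
  assumes "sym E"
  shows "total_variation E x \<le> weighted_norm E x"
proof -
  have "(\<Sum>(i, j)\<in>E. \<bar>x $ i - x $ j\<bar>) \<le> (\<Sum>(i, j)\<in>E. \<bar>x $ i\<bar> + \<bar>x $ j\<bar>)"
    by (rule sum_mono) auto
  also have "\<dots> = (\<Sum>(i, j)\<in>E. \<bar>x $ i\<bar>) + (\<Sum>(i, j)\<in>E. \<bar>x $ j\<bar>)"
    by (simp add: sum.distrib case_prod_unfold)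
  also have "\<dots> = 2 * (\<Sum>(i, j)\<in>E. \<bar>x $ i\<bar>)"
    using sum_edges_swap[OF assms, of "\<lambda>i j. \<bar>x $ j\<bar>"] by simp
  also have "(\<Sum>(i, j)\<in>E. \<bar>x $ i\<bar>) = weighted_norm E x"
    by (simp add: weighted_norm_def degree_def flip: sum_edges)
  finally show ?thesis by (simp add: total_variation_def)
qed

section \<open>Volumes, and positivity in a connected graph\<close>

lemma volume_Un:
  "A \<inter> B = {} \<Longrightarrow> volume E (A \<union> B) = volume E A + volume E B"
  by (simp add: volume_def sum.union_disjoint)

lemma volume_compl: "volume E (- A) = volume E UNIV - volume E A"
  using volume_Un[of A "- A" E] by simp

lemma weighted_norm_two_sets:
  assumes "A \<inter> B = {}"
  shows "weighted_norm E (a *\<^sub>R ind_vec A + b *\<^sub>R ind_vec B) = \<bar>a\<bar> * volume E A + \<bar>b\<bar> * volume E B"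
proof -
  have "weighted_norm E (a *\<^sub>R ind_vec A + b *\<^sub>R ind_vec B)
      = (\<Sum>i\<in>UNIV. \<bar>a\<bar> * (indicator A i * real (degree E i)) + \<bar>b\<bar> * (indicator B i * real (degree E i)))"
    unfolding weighted_norm_def by (rule sum.cong) (use assms in \<open>auto simp: indicator_def\<close>)
  also have "\<dots> = \<bar>a\<bar> * volume E A + \<bar>b\<bar> * volume E B"
    by (simp add: sum.distrib volume_def indicator_def of_bool_def if_distrib[of "\<lambda>c. c * _"] sum.If_cases
        flip: sum_distrib_left)
  finally show ?thesis .
qed

lemma degree_pos:
  fixes E :: "('n::finite \<times> 'n) set"
  assumes "CARD('n) \<ge> 2" and "connected_graph E"
  shows "degree E i > 0"
proof -
  obtain j where "j \<noteq> i"
  proof (rule ccontr)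
    assume "\<not> thesis"
    with that have "UNIV = {i}" by auto
    then have "CARD('n) = card {i}" by (rule arg_cong)
    with assms(1) show False by simp
  qed
  moreover have "(i, j) \<in> E\<^sup>*" using assms(2) by (simp add: connected_graph_def)
  ultimately obtain k where "(i, k) \<in> E" by (auto elim: converse_rtranclE)
  then show ?thesis by (auto simp: degree_def card_gt_0_iff)
qed

lemma volume_pos:
  fixes E :: "('n::finite \<times> 'n) set"
  assumes "CARD('n) \<ge> 2" and "connected_graph E" and "A \<noteq> {}"
  shows "volume E A > 0"
  unfolding volume_def using degree_pos[OF assms(1,2)] assms(3) by (auto intro!: sum_pos)

text \<open>A vanishing cut would make \<open>A\<close> closed under adjacency, so connectedness
  would spread \<open>A\<close> over all vertices.\<close>

lemma total_variation_ind_vec_pos: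
  fixes E :: "('n::finite \<times> 'n) set"
  assumes "connected_graph E" and "A \<noteq> {}" and "A \<noteq> UNIV"
  shows "total_variation E (ind_vec A) > 0"
proof (rule ccontr)
  assume "\<not> ?thesis"
  with total_variation_nonneg[of E "ind_vec A"] have "total_variation E (ind_vec A) = 0" by simp
  then have "(\<Sum>(i, j)\<in>E. \<bar>ind_vec A $ i - ind_vec A $ j\<bar>) = 0"
    by (simp add: total_variation_def)
  then have "\<forall>e\<in>E. (case e of (i, j) \<Rightarrow> \<bar>ind_vec A $ i - ind_vec A $ j\<bar>) = 0"
    by (subst (asm) sum_nonneg_eq_0_iff) auto
  then have closed: "j \<in> A" if "(i, j) \<in> E" "i \<in> A" for i j
    using that by (force simp: indicator_def split: if_splits)
  obtain i where i: "i \<in> A" using assms(2) by blast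
  have "j \<in> A" for j
  proof -
    have "(i, j) \<in> E\<^sup>*" using assms(1) by (simp add: connected_graph_def)
    then show ?thesis by induction (auto simp: i intro: closed)
  qed
  with assms(3) show False by auto
qed

section \<open>Representing a dominated functional as a divergence\<close>

text \<open>The layer-cake argument: lowering the top level of \<open>x\<close> to the next level changes
  both sides by a multiple of their values at the indicator of the top level set.\<close>

lemma inner_le_total_variation:
  fixes q :: "real ^ 'n::finite"
  assumes "sum (($) q) UNIV = 0"
    and sets: "\<And>A. sum (($) q) A \<le> total_variation E (ind_vec A)"
  shows "q \<bullet> x \<le> total_variation E x"
proof (induction "card (range (($) x))" arbitrary: x rule: less_induct)
  case less
  let ?R = "range (($) x)"
  define M where "M = Max ?R"
  show ?case
  proof (cases "?R - {M} = {}")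
    case True
    then have "x $ i = M" for i by auto
    then have "q \<bullet> x = sum (($) q) UNIV * M"
      by (simp add: inner_vec_def sum_distrib_right)
    with assms(1) total_variation_nonneg[of E x] show ?thesis by simp
  next
    case False
    define m where "m = Max (?R - {M})"
    define A where "A = {i. x $ i = M}"
    define y where "y = (\<chi> i. min (x $ i) m)"
    have m: "m \<in> ?R - {M}" using False Max_in[of "?R - {M}"] by (simp add: m_def)
    have M: "M \<in> ?R" using Max_in[of ?R] by (simp add: M_def)
    have le_M: "x $ i \<le> M" for i by (simp add: M_def)
    have mM: "m < M"
    proof -
      obtain i where "m = x $ i" "m \<noteq> M" using m by blast
      then show ?thesis using le_M[of i] by simp
    qed
    have le_m: "x $ i \<le> m" if "x $ i \<noteq> M" for i
      unfolding m_def using that by (intro Max_ge) auto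
    have "range (($) y) \<subseteq> ?R - {M}"
      using m mM by (auto simp: y_def min_def)
    then have "range (($) y) \<subset> ?R" using M by blast
    then have "card (range (($) y)) < card ?R" by (simp add: psubset_card_mono)
    then have IH: "q \<bullet> y \<le> total_variation E y" by (rule less)
    have y_val: "y $ i = (if i \<in> A then m else x $ i)" for i
      using le_m[of i] mM by (auto simp: y_def A_def min_def)
    have "x = y + (M - m) *\<^sub>R ind_vec A"
      by (simp add: vec_eq_iff y_val A_def indicator_def)
    then have "q \<bullet> x = q \<bullet> y + (M - m) * (q \<bullet> ind_vec A)"
      by (simp add: inner_add_right)
    also have "q \<bullet> ind_vec A = sum (($) q) A"
      by (simp add: inner_vec_def indicator_def of_bool_def if_distrib[of "\<lambda>c. _ * c"] sum.If_cases)
    finally have 1: "q \<bullet> x = q \<bullet> y + (M - m) * sum (($) q) A" .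
    \<comment> \<open>There is no cancellation: across an edge leaving \<open>A\<close>, the drop
      from \<open>M\<close> first passes \<open>m\<close>, because every value off \<open>A\<close>
      is at most \<open>m\<close>. Hence the two parts of \<open>x\<close> have additive total
      variation.\<close>
    have "\<bar>x $ i - x $ j\<bar> = \<bar>y $ i - y $ j\<bar> + (M - m) * \<bar>ind_vec A $ i - ind_vec A $ j\<bar>" for i j
      using le_m[of i] le_m[of j] mM by (auto simp: y_val A_def indicator_def)
    then have "total_variation E x = total_variation E y + (M - m) * total_variation E (ind_vec A)"
      by (simp add: total_variation_def sum.distrib sum_distrib_left case_prod_unfold add_divide_distrib)
    moreover have "(M - m) * sum (($) q) A \<le> (M - m) * total_variation E (ind_vec A)"
      using sets mM by (intro mult_left_mono) auto
    ultimately show ?thesis using 1 IH by simp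
  qed
qed

text \<open>The total variation is the support function of the compact convex set of divergences of
  antisymmetric flows bounded by 1. A vector dominated by a support function lies in the set, by
  separation of a point from a closed convex set.\<close>

lemma divergence_representation:
  fixes E :: "('n::finite \<times> 'n) set"
  assumes "sym E" and le: "\<And>x. q \<bullet> x \<le> total_variation E x"
  obtains z where "q = divergence E z" "\<And>i j. z j i = - z i j" "\<And>i j. \<bar>z i j\<bar> \<le> 1"
proof -
  define w :: "real ^ ('n \<times> 'n) \<Rightarrow> 'n \<Rightarrow> 'n \<Rightarrow> real"
    \<comment> \<open>Antisymmetrising an arbitrary array lets a full cube parametrise the flows, so
      that their divergences form a linear image of a box.\<close>
    where "w = (\<lambda>z i j. (z $ (i, j) - z $ (j, i)) / 2)"
  define L where "L = (\<lambda>z. divergence E (w z))"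
  define C :: "(real ^ ('n \<times> 'n)) set" where "C = cbox (- 1) 1"
  have lin: "linear L"
  proof (rule linearI)
    fix y z c
    have "w (y + z) i j = w y i j + w z i j" for i j by (simp add: w_def field_simps)
    then show "L (y + z) = L y + L z" by (simp add: L_def divergence_def vec_eq_iff sum.distrib)
    have "w (c *\<^sub>R z) i j = c * w z i j" for i j by (simp add: w_def field_simps)
    then show "L (c *\<^sub>R z) = c *\<^sub>R L z" by (simp add: L_def divergence_def vec_eq_iff sum_distrib_left)
  qed
  have C: "z \<in> C \<longleftrightarrow> (\<forall>e. \<bar>z $ e\<bar> \<le> 1)" for z
    by (simp add: C_def mem_box_cart abs_le_iff) (metis minus_le_iff)
  have "q \<in> L ` C"
  proof (rule ccontr)
    assume "q \<notin> L ` C"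
    moreover have "convex (L ` C)"
      unfolding C_def by (intro convex_linear_image lin convex_box)
    moreover have "closed (L ` C)"
      unfolding C_def
      by (intro compact_imp_closed compact_continuous_image linear_continuous_on compact_cbox)
        (use lin linear_conv_bounded_linear in blast)
    ultimately obtain a b where ab: "a \<bullet> q < b" "\<And>p. p \<in> L ` C \<Longrightarrow> b < a \<bullet> p"
      using separating_hyperplane_closed_point[of "L ` C" q] by metis
    \<comment> \<open>The flow against the gradient of \<open>a\<close> brings
      \<open>a \<bullet> L z\<close> down to minus the total variation of \<open>a\<close>. The
      separation then contradicts domination of \<open>q\<close> tested at
      \<open>- a\<close>.\<close>
    define z :: "real ^ ('n \<times> 'n)" where "z = (\<chi> e. - sgn (a $ fst e - a $ snd e))"
    have wz: "w z i j = - sgn (a $ i - a $ j)" for i j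
      using sgn_minus[of "a $ i - a $ j"] by (simp add: w_def z_def)
    have "z \<in> C" by (auto simp: C z_def sgn_if)
    then have "b < a \<bullet> L z" using ab(2) by blast
    moreover have "a \<bullet> L z = - total_variation E a"
    proof -
      have "a \<bullet> L z = (\<Sum>(i, j)\<in>E. (a $ i - a $ j) * w z i j) / 2"
        unfolding L_def by (rule inner_divergence[OF assms(1)]) (auto simp: w_def field_simps)
      also have "(\<Sum>(i, j)\<in>E. (a $ i - a $ j) * w z i j) = (\<Sum>(i, j)\<in>E. - \<bar>a $ i - a $ j\<bar>)"
        by (rule sum.cong) (auto simp: wz sgn_if)
      finally show ?thesis by (simp add: total_variation_def sum_negf case_prod_unfold)
    qed
    moreover have "q \<bullet> (- a) \<le> total_variation E a"
      using le[of "- a"] total_variation_scaleR[of E "-1" a] by simp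
    ultimately show False using ab(1) by (simp add: inner_commute)
  qed
  then obtain z where z: "z \<in> C" "q = divergence E (w z)" by (auto simp: L_def)
  show thesis
  proof (rule that[OF z(2)])
    show "w z j i = - w z i j" for i j by (simp add: w_def field_simps)
    show "\<bar>w z i j\<bar> \<le> 1" for i j
    proof -
      have "\<bar>z $ (i, j)\<bar> \<le> 1" "\<bar>z $ (j, i)\<bar> \<le> 1" using z(1) C by blast+
      then show ?thesis by (simp add: w_def abs_le_iff)
    qed
  qed
qed

section \<open>Genus and the second minimax value\<close>

text \<open>Listing the coordinates of a nonzero vector gives such a map in dimension
  \<open>CARD('n)\<close>. This guarantees that the \<open>LEAST\<close> in \<open>genus\<close> is
  attained.\<close>

lemma odd_map_to_punctured_exists:
  fixes A :: "(real ^ 'n::finite) set"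
  assumes "0 \<notin> A"
  shows "\<exists>m f. odd_map_to_punctured A m f"
proof -
  obtain h :: "'n \<Rightarrow> nat" where h: "bij_betw h UNIV {0..<CARD('n)}"
    using ex_bij_betw_finite_nat[of "UNIV :: 'n set"] by auto
  define f :: "real ^ 'n \<Rightarrow> nat \<Rightarrow> real"
    where "f = (\<lambda>x k. if k < CARD('n) then x $ (inv h k) else 0)"
  have fh: "f x (h i) = x $ i" for x i
    using h by (auto simp: f_def bij_betw_def)
  have "continuous_map (top_of_set A) euclideanreal (\<lambda>x. f x k)" for k
    by (cases "k < CARD('n)") (auto simp: f_def intro!: continuous_intros)
  moreover have "f x \<noteq> (\<lambda>i. 0)" if "x \<in> A" for x
  proof
    assume "f x = (\<lambda>i. 0)"
    then have "x $ i = 0" for i using fh[of x i] by simp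
    then have "x = 0" by (simp add: vec_eq_iff)
    with that assms show False by simp
  qed
  ultimately have "odd_map_to_punctured A (CARD('n)) f"
    unfolding odd_map_to_punctured_def Euclidean_space_def
    by (auto simp: continuous_map_in_subtopology continuous_map_componentwise_UNIV)
      (auto simp: f_def)
  then show ?thesis by blast
qed

text \<open>Below dimension 2 an odd map into the punctured space amounts to a single nonvanishing
  odd real function. Such a function changes sign between \<open>x\<close> and \<open>- x\<close>,
  so it must vanish somewhere on the connected set \<open>S\<close>.\<close>

lemma genus_ge_2I:
  fixes A :: "(real ^ 'n::finite) set"
  assumes "0 \<notin> A" "S \<subseteq> A" "connected S" "x \<in> S" "- x \<in> S"
  shows "genus A \<ge> 2"
proof (rule ccontr)
  assume "\<not> genus A \<ge> 2"
  define m where "m = genus A"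
  have "\<exists>f. odd_map_to_punctured A m f"
    unfolding m_def genus_def by (rule LeastI_ex[OF odd_map_to_punctured_exists[OF assms(1)]])
  then obtain f where f: "odd_map_to_punctured A m f" by blast
  have m: "m < 2" using \<open>\<not> genus A \<ge> 2\<close> by (simp add: m_def)
  have cont: "continuous_on A (\<lambda>y. f y 0)"
    using f unfolding odd_map_to_punctured_def Euclidean_space_def
    by (auto simp: continuous_map_in_subtopology continuous_map_componentwise_UNIV)
  have nz: "f y 0 \<noteq> 0" if "y \<in> A" for y
  proof
    assume 0: "f y 0 = 0"
    have "f y \<in> topspace (Euclidean_space m) - {\<lambda>i. 0}"
      using f that unfolding odd_map_to_punctured_def by (auto simp: continuous_map_in_subtopology)
    then have "\<And>i. i \<ge> m \<Longrightarrow> f y i = 0" and "f y \<noteq> (\<lambda>i. 0)"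
      by (auto simp: topspace_Euclidean_space)
    \<comment> \<open>Since \<open>m < 2\<close>, every index other than 0 is at least
      \<open>m\<close> and carries the value 0.\<close>
    moreover have "f y i = 0" for i
      using 0 m calculation(1)[of i] by (cases i) auto
    ultimately show False by auto
  qed
  have "connected ((\<lambda>y. f y 0) ` S)"
    using assms(2,3) cont by (blast intro: connected_continuous_image continuous_on_subset)
  moreover have "f (- x) 0 = - f x 0"
    using f assms unfolding odd_map_to_punctured_def by blast
  then have "f x 0 \<in> (\<lambda>y. f y 0) ` S" "- f x 0 \<in> (\<lambda>y. f y 0) ` S"
    using assms(4,5) by (auto simp: image_iff intro: bexI[of _ "- x"])
  ultimately have "0 \<in> (\<lambda>y. f y 0) ` S"
    unfolding connected_iff_interval by (cases "f x 0 \<ge> 0") (auto simp del: image_iff)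
  with nz assms(2) show False by force
qed

lemma genus_empty: "genus ({} :: 'a::euclidean_space set) = 0"
  unfolding genus_def odd_map_to_punctured_def
  by (rule Least_equality) (auto simp: continuous_map_def)

lemma zero_notin_unit_set: "0 \<notin> unit_set E"
  by (simp add: unit_set_def)

section \<open>Upper bounds for the minimax value from test sets\<close>

lemma minimax_value_le:
  fixes E :: "('n::finite \<times> 'n) set"
  assumes "sym E" "k \<ge> 1" "closed A" "uminus ` A = A" "A \<subseteq> unit_set E" "k \<le> genus A"
    and bound: "\<And>x. x \<in> A \<Longrightarrow> total_variation E x \<le> b"
  shows "minimax_value E k \<le> b"
proof -
  let ?F = "{A. closed A \<and> uminus ` A = A \<and> A \<subseteq> unit_set E \<and> k \<le> genus A}"
  \<comment> \<open>Real \<open>SUP\<close> and \<open>INF\<close> are meaningful only for nonempty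
    bounded families. As \<open>k \<ge> 1\<close>, the empty set, of genus 0, is no
    competitor.\<close>
  have ne: "B \<noteq> {}" if "B \<in> ?F" for B using that \<open>k \<ge> 1\<close> by (auto simp: genus_empty)
  have bdd: "bdd_above (total_variation E ` B)" if "B \<in> ?F" for B
  proof (rule bdd_aboveI2)
    fix x assume "x \<in> B"
    with that have "weighted_norm E x = 1" by (auto simp: unit_set_iff)
    then show "total_variation E x \<le> 1"
      using total_variation_le_weighted_norm[OF assms(1), of x] by simp
  qed
  have "0 \<le> (SUP x\<in>B. total_variation E x)" if "B \<in> ?F" for B
  proof -
    obtain x where "x \<in> B" using ne[OF \<open>B \<in> ?F\<close>] by blast
    then have "total_variation E x \<le> (SUP x\<in>B. total_variation E x)"
      by (rule cSUP_upper[OF _ bdd[OF that]])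
    with total_variation_nonneg[of E x] show ?thesis by (rule order_trans)
  qed
  then have "bdd_below ((\<lambda>B. SUP x\<in>B. total_variation E x) ` ?F)" by (intro bdd_belowI2)
  then have "minimax_value E k \<le> (SUP x\<in>A. total_variation E x)"
    unfolding minimax_value_def by (rule cINF_lower) (use assms in auto)
  also have "\<dots> \<le> b" by (rule cSUP_least) (use ne assms in auto)
  finally show ?thesis .
qed

text \<open>On a combination of the two indicators with coefficients \<open>a\<close> and
  \<open>b\<close>, the total variation is at most \<open>\<bar>a\<bar> + \<bar>b\<bar>\<close>
  times the cut, and the norm is at least \<open>\<bar>a\<bar> + \<bar>b\<bar>\<close> times the
  smaller volume. Hence the normalised circle has total variation at most their ratio.\<close>

lemma cheeger_bound:
  fixes E :: "('n::finite \<times> 'n) set"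
  assumes "CARD('n) \<ge> 2" "sym E" "connected_graph E"
    and A: "A \<noteq> {}" "A \<noteq> UNIV"
  shows "minimax_value E 2 * min (volume E A) (volume E (- A)) \<le> total_variation E (ind_vec A)"
proof -
  define v where "v = min (volume E A) (volume E (- A))"
  define t where "t = total_variation E (ind_vec A)"
  \<comment> \<open>The complex unit circle parametrises directions in the plane of the two
    indicators. \<open>N p\<close> is the weighted norm of \<open>g p\<close>, and \<open>G\<close>
    projects radially onto \<open>unit_set E\<close>.\<close>
  define g where "g = (\<lambda>p. Re p *\<^sub>R ind_vec A + Im p *\<^sub>R (ind_vec (- A) :: real ^ 'n))"
  define N where "N = (\<lambda>p. \<bar>Re p\<bar> * volume E A + \<bar>Im p\<bar> * volume E (- A))"
  define G where "G = (\<lambda>p. inverse (N p) *\<^sub>R g p)"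
  have pos: "volume E A > 0" "volume E (- A) > 0"
    using A by (auto intro!: volume_pos[OF assms(1,3)])
  then have v: "v > 0" by (simp add: v_def)
  have Ng: "weighted_norm E (g p) = N p" for p
    by (simp add: g_def N_def weighted_norm_two_sets)
  have N: "N p > 0" if "p \<in> sphere 0 1" for p
  proof -
    have "p \<noteq> 0" using that by auto
    then consider "Re p \<noteq> 0" | "Im p \<noteq> 0" by (auto simp: complex_eq_iff)
    then show ?thesis
      by cases (use pos in \<open>auto simp: N_def intro: add_pos_nonneg add_nonneg_pos\<close>)
  qed
  have odd: "G (- p) = - G p" for p by (simp add: G_def g_def N_def algebra_simps)
  have cont: "continuous_on (sphere 0 1) G"
    unfolding G_def using N by (auto simp: g_def N_def intro!: continuous_intros) fastforce
  have sub: "G ` sphere 0 1 \<subseteq> unit_set E"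
  proof
    fix x assume "x \<in> G ` sphere 0 1"
    then obtain p where p: "p \<in> sphere 0 1" "x = G p" by blast
    have "weighted_norm E (G p) = \<bar>inverse (N p)\<bar> * weighted_norm E (g p)"
      by (simp add: G_def weighted_norm_def abs_mult sum_distrib_left algebra_simps)
    then show "x \<in> unit_set E" using N[OF p(1)] by (simp add: unit_set_iff p(2) Ng)
  qed
  have "minimax_value E 2 \<le> t / v"
  proof (rule minimax_value_le[OF assms(2), of 2 "G ` sphere 0 1"])
    show "closed (G ` sphere 0 1)"
      using cont by (intro compact_imp_closed compact_continuous_image) auto
    show "uminus ` G ` sphere 0 1 = G ` sphere 0 1"
    proof -
      have "uminus ` G ` sphere 0 1 = G ` uminus ` sphere 0 1"
        by (simp add: image_image odd)
      also have "uminus ` sphere 0 1 = sphere (0::complex) 1"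
        by (auto intro: image_eqI[of _ _ "- x" for x])
      finally show ?thesis .
    qed
    show "2 \<le> genus (G ` sphere 0 1)"
    proof (rule genus_ge_2I)
      show "0 \<notin> G ` sphere 0 1" using sub zero_notin_unit_set by blast
      show "connected (G ` sphere 0 1)"
        using cont by (intro connected_continuous_image connected_sphere) auto
      show "G 1 \<in> G ` sphere 0 1" by simp
      show "- G 1 \<in> G ` sphere 0 1" by (simp flip: odd)
    qed auto
    show "total_variation E x \<le> t / v" if "x \<in> G ` sphere 0 1" for x
    proof -
      obtain p where p: "p \<in> sphere 0 1" "x = G p" using \<open>x \<in> G ` sphere 0 1\<close> by blast
      have "total_variation E (g p) \<le> total_variation E (Re p *\<^sub>R ind_vec A)
          + total_variation E (Im p *\<^sub>R ind_vec (- A))"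
        unfolding g_def by (rule total_variation_add_le)
      also have "\<dots> = (\<bar>Re p\<bar> + \<bar>Im p\<bar>) * t"
        by (simp only: total_variation_scaleR total_variation_compl t_def ring_distribs)
      finally have 1: "total_variation E (g p) \<le> (\<bar>Re p\<bar> + \<bar>Im p\<bar>) * t" .
      have "(\<bar>Re p\<bar> + \<bar>Im p\<bar>) * v \<le> N p"
        unfolding N_def ring_distribs by (intro add_mono mult_left_mono) (auto simp: v_def)
      then have "(\<bar>Re p\<bar> + \<bar>Im p\<bar>) * v * t \<le> N p * t"
        by (rule mult_right_mono) (simp add: t_def total_variation_nonneg)
      with 1 v have "total_variation E (g p) * v \<le> N p * t"
        by (smt (verit) mult.assoc mult.commute mult_right_mono)
      then have "total_variation E (g p) / N p \<le> t / v"
        using v N[OF p(1)] by (simp add: field_simps)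
      then show ?thesis
        using N[OF p(1)] by (simp add: p(2) G_def total_variation_scaleR divide_inverse mult.commute)
    qed
  qed (use sub in auto)
  then show ?thesis using v by (simp add: t_def v_def field_simps)
qed

section \<open>Eigenvectors at the second minimax value\<close>

text \<open>The condition on \<open>s\<close> says that 0 is a weighted median of \<open>u\<close>.\<close>

lemma is_eigenvectorI_median:
  fixes E :: "('n::finite \<times> 'n) set"
  assumes "CARD('n) \<ge> 2" "sym E" "connected_graph E"
    and \<mu>: "\<mu> = minimax_value E 2" "\<mu> \<ge> 0"
    and "u \<noteq> 0" and tv: "total_variation E u \<le> \<mu> * weighted_norm E u"
    and s: "\<And>i. s i \<in> Sgn (u $ i)" "(\<Sum>i\<in>UNIV. real (degree E i) * s i) = 0"
  shows "is_eigenvector E \<mu> u"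
proof -
  \<comment> \<open>The right-hand side of the desired eigenvector equation; it remains to realise
    it as the divergence of a flow compatible with \<open>u\<close>.\<close>
  define q :: "real ^ 'n" where "q = (\<chi> i. \<mu> * (real (degree E i) * s i))"
  have s1: "\<bar>s i\<bar> \<le> 1" for i using s(1)[of i] by (auto simp: Sgn_def split: if_splits)
  have q0: "sum (($) q) UNIV = 0"
    by (simp add: q_def s(2) flip: sum_distrib_left)
  have qA: "\<bar>sum (($) q) A\<bar> \<le> \<mu> * volume E A" for A
  proof -
    have "\<bar>sum (($) q) A\<bar> \<le> (\<Sum>i\<in>A. \<bar>q $ i\<bar>)" by (rule sum_abs)
    also have "\<dots> \<le> (\<Sum>i\<in>A. \<mu> * real (degree E i))"
      using s1 \<mu>(2) by (intro sum_mono) (auto simp: q_def abs_mult intro!: mult_left_mono mult_left_le)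
    finally show ?thesis by (simp add: volume_def sum_distrib_left)
  qed
  have "sum (($) q) A \<le> total_variation E (ind_vec A)" for A
  proof (cases "A = {} \<or> A = UNIV")
    case True
    then show ?thesis using q0 total_variation_nonneg[of E "ind_vec A"] by auto
  next
    case False
    \<comment> \<open>As \<open>q\<close> has total sum 0, its sums over \<open>A\<close> and
      \<open>- A\<close> are opposite, so both volumes bound the sum over \<open>A\<close>.\<close>
    have "sum (($) q) (- A) = - sum (($) q) A"
      using q0 sum.union_disjoint[of A "- A" "($) q"] by simp
    then have "sum (($) q) A \<le> \<mu> * volume E A" "sum (($) q) A \<le> \<mu> * volume E (- A)"
      using qA[of A] qA[of "- A"] by auto
    then have "sum (($) q) A \<le> \<mu> * min (volume E A) (volume E (- A))" by (simp add: min_def)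
    also have "\<dots> \<le> total_variation E (ind_vec A)"
      unfolding \<mu>(1) using False by (intro cheeger_bound assms) auto
    finally show ?thesis .
  qed
  then have "\<And>x. q \<bullet> x \<le> total_variation E x" using q0 by (rule inner_le_total_variation[rotated])
  then obtain z where z: "q = divergence E z" "\<And>i j. z j i = - z i j" "\<And>i j. \<bar>z i j\<bar> \<le> 1"
    using divergence_representation[OF assms(2)] by blast
  have "u \<bullet> q = \<mu> * weighted_norm E u"
  proof -
    have "u $ i * s i = \<bar>u $ i\<bar>" for i using s(1)[of i] by (auto simp: Sgn_def split: if_splits)
    then have "u $ i * q $ i = \<mu> * (real (degree E i) * \<bar>u $ i\<bar>)" for i
      by (simp add: q_def)
    then show ?thesis by (simp add: inner_vec_def weighted_norm_def sum_distrib_left)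
  qed
  \<comment> \<open>The edge terms of \<open>u \<bullet> q\<close> are at most those of the total
    variation, while the sums compare the other way. So equality holds on each edge, which says that
    \<open>z i j\<close> is a sign of the difference.\<close>
  with tv have "total_variation E u \<le> u \<bullet> q" by simp
  also have "u \<bullet> q = (\<Sum>(i, j)\<in>E. (u $ i - u $ j) * z i j) / 2"
    unfolding z(1) by (rule inner_divergence[OF assms(2)]) (rule z(2))
  finally have "(\<Sum>(i, j)\<in>E. \<bar>u $ i - u $ j\<bar> - (u $ i - u $ j) * z i j) \<le> 0"
    by (simp add: total_variation_def sum_subtractf case_prod_unfold)
  moreover have nn: "(u $ i - u $ j) * z i j \<le> \<bar>u $ i - u $ j\<bar>" for i j
  proof -
    have "\<bar>(u $ i - u $ j) * z i j\<bar> \<le> \<bar>u $ i - u $ j\<bar>"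
      unfolding abs_mult using z(3)[of i j] by (intro mult_left_le) auto
    then show ?thesis by simp
  qed
  ultimately have "(\<Sum>(i, j)\<in>E. \<bar>u $ i - u $ j\<bar> - (u $ i - u $ j) * z i j) = 0"
    by (intro antisym sum_nonneg) auto
  then have "\<forall>e\<in>E. (case e of (i, j) \<Rightarrow> \<bar>u $ i - u $ j\<bar> - (u $ i - u $ j) * z i j) = 0"
    by (subst (asm) sum_nonneg_eq_0_iff) (use nn in auto)
  then have eq: "(u $ i - u $ j) * z i j = \<bar>u $ i - u $ j\<bar>" if "(i, j) \<in> E" for i j
    using that by force
  have "z i j \<in> Sgn (u $ i - u $ j)" if "(i, j) \<in> E" for i j
    using eq[OF that] z(3)[of i j]
  proof (cases "u $ i - u $ j" "0 :: real" rule: linorder_cases)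
    case less
    then have "(u $ i - u $ j) * z i j = (u $ i - u $ j) * - 1" using eq[OF that] by simp
    with less have "z i j = - 1" by (simp only: mult_cancel_left) simp
    with less show ?thesis by (simp add: Sgn_def)
  qed (use eq[OF that] z(3)[of i j] in \<open>auto simp: Sgn_def abs_le_iff\<close>)
  moreover have "(\<Sum>j\<in>E `` {i}. z i j) \<in> (\<lambda>s. \<mu> * real (degree E i) * s) ` Sgn (u $ i)" for i
  proof -
    have "(\<Sum>j\<in>E `` {i}. z i j) = q $ i" by (simp add: z(1) divergence_def)
    then show ?thesis using s(1)[of i] by (auto simp: q_def)
  qed
  ultimately show ?thesis
    unfolding is_eigenvector_def using \<open>u \<noteq> 0\<close> z(2) by blast
qed

text \<open>Disjoint supports keep the weighted norm equal to 1 along the segment, and subadditivity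
  keeps the total variation at most \<mu>. The volume bounds keep 0 a weighted median.\<close>

lemma segment_subset_eigenset:
  fixes E :: "('n::finite \<times> 'n) set"
  assumes "CARD('n) \<ge> 2" "sym E" "connected_graph E"
    and \<mu>: "\<mu> = minimax_value E 2" "\<mu> \<ge> 0"
    and "A \<noteq> {}" "B \<noteq> {}" and disj: "A \<inter> B = {}"
    and A: "2 * volume E A \<le> volume E UNIV" "total_variation E (ind_vec A) \<le> \<mu> * volume E A"
    and B: "2 * volume E B \<le> volume E UNIV" "total_variation E (ind_vec B) \<le> \<mu> * volume E B"
  shows "closed_segment (ind_vec A /\<^sub>R volume E A) (- (ind_vec B /\<^sub>R volume E B)) \<subseteq> eigenset E \<mu>"
proof
  fix u assume "u \<in> closed_segment (ind_vec A /\<^sub>R volume E A) (- (ind_vec B /\<^sub>R volume E B))"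
  then obtain t where t: "0 \<le> t" "t \<le> 1"
    and u': "u = (1 - t) *\<^sub>R (ind_vec A /\<^sub>R volume E A) + t *\<^sub>R - (ind_vec B /\<^sub>R volume E B)"
    by (auto simp: in_segment)
  define a where "a = (1 - t) / volume E A"
  define b where "b = t / volume E B"
  define R where "R = - (A \<union> B)"
  \<comment> \<open>The sign value on the remaining vertices, where \<open>u\<close> is 0, chosen to
    balance \<open>A\<close> against \<open>B\<close>. It lies in [-1,1] because neither volume
    exceeds half the total; if \<open>volume E R = 0\<close>, the two volumes agree and
    \<open>c\<close> is 0.\<close>
  define c where "c = (volume E B - volume E A) / volume E R"
  define s :: "'n \<Rightarrow> real" where "s = (\<lambda>i. if i \<in> A then 1 else if i \<in> B then - 1 else c)"
  have pos: "volume E A > 0" "volume E B > 0"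
    using assms volume_pos by blast+
  have ab: "a \<ge> 0" "b \<ge> 0" "a * volume E A = 1 - t" "b * volume E B = t"
    using t pos by (auto simp: a_def b_def)
  have u: "u = a *\<^sub>R ind_vec A + (- b) *\<^sub>R ind_vec B"
    by (simp add: u' a_def b_def divide_inverse)
  have norm: "weighted_norm E u = 1"
    unfolding u weighted_norm_two_sets[OF disj] using ab by simp
  have "total_variation E u \<le> a * total_variation E (ind_vec A) + b * total_variation E (ind_vec B)"
    unfolding u using total_variation_add_le[of E "a *\<^sub>R ind_vec A" "(- b) *\<^sub>R ind_vec B"] ab
    by (simp only: total_variation_scaleR) simp
  also have "\<dots> \<le> a * (\<mu> * volume E A) + b * (\<mu> * volume E B)"
    using ab A B by (intro add_mono mult_left_mono) auto
  also have "\<dots> = \<mu> * (a * volume E A + b * volume E B)" by (simp add: algebra_simps)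
  finally have tv: "total_variation E u \<le> \<mu>" using ab by simp
  have vol: "volume E UNIV = volume E A + volume E B + volume E R"
    using volume_compl[of E "A \<union> B"] volume_Un[OF disj, of E] by (simp add: R_def)
  have R0: "volume E R \<ge> 0" by (simp add: volume_def sum_nonneg)
  have c1: "\<bar>c\<bar> \<le> 1"
    using A(1) B(1) vol R0 by (auto simp: c_def abs_le_iff divide_le_eq le_divide_eq)
  have cR: "c * volume E R = volume E B - volume E A"
    using A(1) B(1) vol R0 by (auto simp: c_def)
  have "(\<Sum>i\<in>UNIV. real (degree E i) * s i)
      = (\<Sum>i\<in>A. real (degree E i) * s i) + (\<Sum>i\<in>B. real (degree E i) * s i)
        + (\<Sum>i\<in>R. real (degree E i) * s i)"
  proof -
    have "UNIV = (A \<union> B) \<union> R" by (auto simp: R_def)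
    then have "(\<Sum>i\<in>UNIV. real (degree E i) * s i) = (\<Sum>i\<in>(A \<union> B) \<union> R. real (degree E i) * s i)"
      by (rule arg_cong)
    also have "\<dots> = (\<Sum>i\<in>A \<union> B. real (degree E i) * s i) + (\<Sum>i\<in>R. real (degree E i) * s i)"
      by (rule sum.union_disjoint) (auto simp: R_def)
    finally show ?thesis using disj by (simp add: sum.union_disjoint)
  qed
  also have "(\<Sum>i\<in>A. real (degree E i) * s i) = volume E A"
    by (simp add: volume_def s_def)
  also have "(\<Sum>i\<in>B. real (degree E i) * s i) = (\<Sum>i\<in>B. - real (degree E i))"
    by (rule sum.cong) (use disj in \<open>auto simp: s_def\<close>)
  also have "\<dots> = - volume E B" by (simp add: volume_def sum_negf)
  also have "(\<Sum>i\<in>R. real (degree E i) * s i) = (\<Sum>i\<in>R. real (degree E i) * c)"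
    by (rule sum.cong) (auto simp: s_def R_def)
  also have "\<dots> = c * volume E R" by (simp add: volume_def sum_distrib_left mult.commute)
  finally have s0: "(\<Sum>i\<in>UNIV. real (degree E i) * s i) = 0" using cR by simp
  have sS: "s i \<in> Sgn (u $ i)" for i
    using ab(1,2) disj c1 by (auto simp: s_def u Sgn_def indicator_def abs_le_iff)
  have "u \<noteq> 0" using norm by (auto simp: weighted_norm_def)
  then have "is_eigenvector E \<mu> u"
    by (rule is_eigenvectorI_median[OF assms(1-3) \<mu> _ _ sS s0]) (simp add: tv norm)
  then show "u \<in> eigenset E \<mu>" using norm by (simp add: eigenset_def unit_set_iff)
qed

section \<open>Nodal domains\<close>

text \<open>The last claim is maximality: an edge leaving a component of the subgraph on
  \<open>U\<close> must leave \<open>U\<close>. For nodal domains this forces a loss of the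
  sign.\<close>

lemma component_properties:
  assumes "D \<in> components_on E U"
  shows "D \<noteq> {}" "D \<subseteq> U" "\<And>i j. i \<in> D \<Longrightarrow> (i, j) \<in> E \<Longrightarrow> j \<in> U \<Longrightarrow> j \<in> D"
proof -
  obtain k where k: "k \<in> U" "D = (Restr E U)\<^sup>* `` {k}"
    using assms by (auto simp: components_on_def elim: quotientE)
  then show "D \<noteq> {}" by auto
  show sub: "D \<subseteq> U"
  proof
    fix i assume "i \<in> D"
    then have "(k, i) \<in> (Restr E U)\<^sup>*" by (simp add: k)
    then show "i \<in> U" by induction (use k in auto)
  qed
  show "j \<in> D" if "i \<in> D" "(i, j) \<in> E" "j \<in> U" for i j
  proof -
    have "(i, j) \<in> Restr E U" using that sub by auto
    moreover have "(k, i) \<in> (Restr E U)\<^sup>*" using that(1) by (simp add: k)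
    ultimately show ?thesis by (auto simp: k intro: rtrancl_into_rtrancl)
  qed
qed

lemma components_on_disjoint:
  assumes "sym E" "D \<in> components_on E U" "D' \<in> components_on E U" "D \<noteq> D'"
  shows "D \<inter> D' = {}"
proof -
  have "sym (Restr E U)" using assms(1) by (auto simp: sym_def)
  \<comment> \<open>The reflexive closure ranges over the whole vertex type, so the equivalence
    lives on \<open>UNIV\<close> and not on \<open>U\<close>.\<close>
  then have "equiv UNIV ((Restr E U)\<^sup>*)"
    by (intro equivI) (auto simp: sym_rtrancl trans_rtrancl refl_rtrancl)
  moreover have "D \<in> UNIV // (Restr E U)\<^sup>*" "D' \<in> UNIV // (Restr E U)\<^sup>*"
    using assms(2,3) by (auto simp: components_on_def quotient_def)
  ultimately show ?thesis using quotient_disj assms(4) by blast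
qed

text \<open>The sign \<sigma> lets positive and negative domains share one argument below.\<close>

lemma nodal_domain_signE:
  assumes "D \<in> nodal_domains E x"
  obtains \<sigma> :: real where "\<sigma> = 1 \<or> \<sigma> = - 1" "D \<in> components_on E {i. \<sigma> * x $ i > 0}"
  using assms that[of 1] that[of "- 1"] by (auto simp: nodal_domains_def)

lemma nodal_domains_disjoint:
  assumes "sym E" "D \<in> nodal_domains E x" "D' \<in> nodal_domains E x" "D \<noteq> D'"
  shows "D \<inter> D' = {}"
proof -
  have "D \<subseteq> {i. x $ i > 0}" if "D \<in> components_on E {i. x $ i > 0}" for D
    using that by (rule component_properties(2))
  moreover have "D \<subseteq> {i. x $ i < 0}" if "D \<in> components_on E {i. x $ i < 0}" for D
    using that by (rule component_properties(2))
  moreover have "{i. x $ i > 0} \<inter> {i. x $ i < 0} = {}" by auto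
  moreover note components_on_disjoint[OF assms(1) _ _ assms(4)]
  ultimately show ?thesis
    using assms(2,3) unfolding nodal_domains_def by blast
qed

text \<open>Sum the eigenvector equation over \<open>D\<close>. Inner edges cancel by antisymmetry,
  and every edge leaving \<open>D\<close> carries the flow \<sigma>, so the left side is \<sigma>
  times the cut and the right side is \<sigma> \<mu> times the volume.\<close>

lemma nodal_domain_total_variation:
  fixes E :: "('n::finite \<times> 'n) set"
  assumes "sym E" "is_eigenvector E \<mu> \<phi>" "D \<in> nodal_domains E \<phi>"
  shows "total_variation E (ind_vec D) = \<mu> * volume E D"
proof -
  obtain z where z: "\<And>i j. (i, j) \<in> E \<Longrightarrow> z i j \<in> Sgn (\<phi> $ i - \<phi> $ j)"
      "\<And>i j. (i, j) \<in> E \<Longrightarrow> z j i = - z i j"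
      "\<And>i. (\<Sum>j\<in>E `` {i}. z i j) \<in> (\<lambda>s. \<mu> * real (degree E i) * s) ` Sgn (\<phi> $ i)"
    using assms(2) unfolding is_eigenvector_def by blast
  obtain \<sigma> where \<sigma>: "\<sigma> = 1 \<or> \<sigma> = - 1" and D: "D \<in> components_on E {i. \<sigma> * \<phi> $ i > 0}"
    using assms(3) by (rule nodal_domain_signE)
  note cp = component_properties[OF D]
  have "ind_vec D \<bullet> divergence E z = (\<Sum>i\<in>D. \<Sum>j\<in>E `` {i}. z i j)"
    by (simp add: inner_vec_def divergence_def indicator_def of_bool_def if_distrib[of "\<lambda>c. c * _"] sum.If_cases)
  also have "\<dots> = (\<Sum>i\<in>D. \<sigma> * \<mu> * real (degree E i))"
  proof (rule sum.cong)
    fix i assume "i \<in> D"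
    then have "\<sigma> * \<phi> $ i > 0" using cp(2) by auto
    then have "Sgn (\<phi> $ i) = {\<sigma>}" using \<sigma> by (auto simp: Sgn_def)
    then show "(\<Sum>j\<in>E `` {i}. z i j) = \<sigma> * \<mu> * real (degree E i)" using z(3)[of i] by simp
  qed simp
  also have "\<dots> = \<sigma> * (\<mu> * volume E D)" by (simp add: volume_def sum_distrib_left mult.assoc)
  finally have 1: "ind_vec D \<bullet> divergence E z = \<sigma> * (\<mu> * volume E D)" .
  have "(ind_vec D $ i - ind_vec D $ j) * z i j = \<sigma> * \<bar>ind_vec D $ i - ind_vec D $ j\<bar>"
    if "(i, j) \<in> E" for i j
  proof -
    \<comment> \<open>Across such an edge \<open>\<sigma> * \<phi>\<close> drops strictly from a
      positive to a nonpositive value, which leaves a single choice in \<open>Sgn\<close>.\<close>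
    have out: "z i j = \<sigma>" if "i \<in> D" "j \<notin> D" "(i, j) \<in> E" for i j
    proof -
      have "\<sigma> * \<phi> $ i > 0" "\<not> \<sigma> * \<phi> $ j > 0" using that cp by auto
      then show ?thesis using z(1)[OF that(3)] \<sigma> by (auto simp: Sgn_def split: if_splits)
    qed
    show ?thesis using out[of i j] out[of j i] z(2)[OF that] that assms(1)
      by (auto simp: indicator_def dest: symD)
  qed
  then have "(\<Sum>(i, j)\<in>E. (ind_vec D $ i - ind_vec D $ j) * z i j)
      = (\<Sum>(i, j)\<in>E. \<sigma> * \<bar>ind_vec D $ i - ind_vec D $ j\<bar>)"
    by (intro sum.cong) auto
  also have "\<dots> = \<sigma> * (2 * total_variation E (ind_vec D))"
    by (simp add: total_variation_def case_prod_unfold flip: sum_distrib_left)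
  finally have "ind_vec D \<bullet> divergence E z = \<sigma> * total_variation E (ind_vec D)"
    using inner_divergence[OF assms(1), of z "ind_vec D"] z(2) by simp
  with 1 \<sigma> show ?thesis by auto
qed

text \<open>Summed over all vertices, the divergence vanishes, so for nonzero \<mu> the
  degree-weighted multipliers \<open>s i\<close> add up to 0. They equal \<sigma> on
  \<open>D\<close>, and values of modulus at most 1 on the complement must compensate.\<close>

lemma nodal_domain_volume:
  fixes E :: "('n::finite \<times> 'n) set"
  assumes "sym E" "is_eigenvector E \<mu> \<phi>" "\<mu> \<noteq> 0" "D \<in> nodal_domains E \<phi>"
  shows "2 * volume E D \<le> volume E UNIV"
proof -
  obtain z where z: "\<And>i j. (i, j) \<in> E \<Longrightarrow> z j i = - z i j"
      "\<And>i. (\<Sum>j\<in>E `` {i}. z i j) \<in> (\<lambda>s. \<mu> * real (degree E i) * s) ` Sgn (\<phi> $ i)"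
    using assms(2) unfolding is_eigenvector_def by blast
  have "\<forall>i. \<exists>s. s \<in> Sgn (\<phi> $ i) \<and> (\<Sum>j\<in>E `` {i}. z i j) = \<mu> * (real (degree E i) * s)"
    using z(2) by (force simp: image_iff)
  then obtain s where s: "\<And>i. s i \<in> Sgn (\<phi> $ i)"
      "\<And>i. (\<Sum>j\<in>E `` {i}. z i j) = \<mu> * (real (degree E i) * s i)" by metis
  have "(\<Sum>i\<in>UNIV. \<Sum>j\<in>E `` {i}. z i j) = (1 :: real ^ 'n) \<bullet> divergence E z"
    by (simp add: inner_vec_def divergence_def)
  also have "\<dots> = 0" using inner_divergence[OF assms(1), of z 1] z(1) by simp
  finally have "\<mu> * (\<Sum>i\<in>UNIV. real (degree E i) * s i) = 0"
    by (simp add: s(2) sum_distrib_left)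
  with assms(3) have s0: "(\<Sum>i\<in>UNIV. real (degree E i) * s i) = 0" by simp
  have s1: "\<bar>s i\<bar> \<le> 1" for i using s(1)[of i] by (auto simp: Sgn_def split: if_splits)
  obtain \<sigma> where \<sigma>: "\<sigma> = 1 \<or> \<sigma> = - 1" and D: "D \<in> components_on E {i. \<sigma> * \<phi> $ i > 0}"
    using assms(4) by (rule nodal_domain_signE)
  note cp = component_properties[OF D]
  have sD: "s i = \<sigma>" if "i \<in> D" for i
  proof -
    have "\<sigma> * \<phi> $ i > 0" using cp(2) that by auto
    then show ?thesis using s(1)[of i] \<sigma> by (auto simp: Sgn_def)
  qed
  have "volume E D = \<sigma> * (\<Sum>i\<in>D. real (degree E i) * s i)"
    using \<sigma> by (auto simp: sum_distrib_left volume_def sD)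
  also have "(\<Sum>i\<in>D. real (degree E i) * s i) = - (\<Sum>i\<in>- D. real (degree E i) * s i)"
    using s0 sum.union_disjoint[of D "- D" "\<lambda>i. real (degree E i) * s i"] by simp
  finally have "volume E D \<le> \<bar>\<Sum>i\<in>- D. real (degree E i) * s i\<bar>" using \<sigma> by auto
  also have "\<dots> \<le> (\<Sum>i\<in>- D. \<bar>real (degree E i) * s i\<bar>)" by (rule sum_abs)
  also have "\<dots> \<le> volume E (- D)"
    unfolding volume_def by (rule sum_mono) (auto simp: abs_mult intro!: mult_left_le s1)
  finally show ?thesis by (simp add: volume_compl)
qed

section \<open>From three nodal domains to genus at least two\<close>

lemma nodal_count_le_2:
  fixes E :: "('n::finite \<times> 'n) set"
  assumes "CARD('n) \<ge> 2" "sym E" "connected_graph E"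
    and genus: "genus (eigenset E (minimax_value E 2)) < 2"
    and \<phi>: "\<phi> \<in> eigenset E (minimax_value E 2)"
  shows "nodal_count E \<phi> \<le> 2"
proof (rule ccontr)
  assume "\<not> ?thesis"
  then have "3 \<le> card (nodal_domains E \<phi>)" by (simp add: nodal_count_def)
  then obtain T where T: "T \<subseteq> nodal_domains E \<phi>" "card T = 3"
    by (meson obtain_subset_with_card_n)
  then obtain D1 D2 D3 where D: "T = {D1, D2, D3}" "D1 \<noteq> D2" "D1 \<noteq> D3" "D2 \<noteq> D3"
    by (auto simp: card_3_iff)
  define \<mu> where "\<mu> = minimax_value E 2"
  have eig: "is_eigenvector E \<mu> \<phi>" using \<phi> by (simp add: eigenset_def \<mu>_def)
  have ne: "X \<noteq> {}" if "X \<in> T" for X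
    using that T(1) component_properties(1) by (auto simp: nodal_domains_def)
  have disj: "X \<inter> Y = {}" if "X \<in> T" "Y \<in> T" "X \<noteq> Y" for X Y
    using that T(1) nodal_domains_disjoint[OF assms(2)] by blast
  have tv: "total_variation E (ind_vec X) = \<mu> * volume E X" if "X \<in> T" for X
    using that T(1) nodal_domain_total_variation[OF assms(2) eig] by blast
  \<comment> \<open>A second domain makes \<open>D1\<close> a proper subset. Its cut is then
    positive, and this forces \<mu> to be positive.\<close>
  have "D1 \<noteq> UNIV" using disj[of D1 D2] ne[of D2] D by auto
  then have "total_variation E (ind_vec D1) > 0"
    using ne[of D1] D(1) by (intro total_variation_ind_vec_pos[OF assms(3)]) auto
  then have \<mu>0: "\<mu> > 0"
    using tv[of D1] D(1) volume_pos[OF assms(1,3) ne[of D1]] by (simp add: zero_less_mult_iff)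
  have vol: "2 * volume E X \<le> volume E UNIV" if "X \<in> T" for X
    using that T(1) \<mu>0 by (intro nodal_domain_volume[OF assms(2) eig]) auto
  define e where "e = (\<lambda>X. (ind_vec X :: real ^ 'n) /\<^sub>R volume E X)"
  have seg: "closed_segment (e X) (- e Y) \<subseteq> eigenset E \<mu>" if "X \<in> T" "Y \<in> T" "X \<noteq> Y" for X Y
    unfolding e_def
    by (rule segment_subset_eigenset[OF assms(1-3) \<mu>_def]) (use that \<mu>0 ne disj vol tv in auto)
  \<comment> \<open>Each admissible segment changes both the sign and the domain, so the third
    domain provides the detour by which \<open>e D1\<close> reaches its own antipode.\<close>
  define S where "S = closed_segment (e D1) (- e D2) \<union> closed_segment (- e D2) (e D3)
    \<union> closed_segment (e D3) (- e D1)"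
  have "S \<subseteq> eigenset E \<mu>"
    using seg[of D1 D2] seg[of D3 D2] seg[of D3 D1] D unfolding S_def
    by (simp add: closed_segment_commute)
  moreover have "connected S"
  proof -
    have "connected (closed_segment (e D1) (- e D2) \<union> closed_segment (- e D2) (e D3))"
      by (rule connected_Un) (auto intro: ends_in_segment)
    moreover have "e D3 \<in> (closed_segment (e D1) (- e D2) \<union> closed_segment (- e D2) (e D3))
        \<inter> closed_segment (e D3) (- e D1)" by simp
    ultimately show ?thesis unfolding S_def by (intro connected_Un) auto
  qed
  moreover have "e D1 \<in> S" "- e D1 \<in> S" by (auto simp: S_def)
  moreover have "0 \<notin> eigenset E \<mu>" using zero_notin_unit_set by (auto simp: eigenset_def)
  ultimately have "genus (eigenset E \<mu>) \<ge> 2" by (intro genus_ge_2I)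
  with genus show False by (simp add: \<mu>_def)
qed

theorem theorem9:
  fixes E :: "('n::finite \<times> 'n) set"
  assumes "CARD('n) \<ge> 2"
    and "sym E" and "irrefl E"
    and "connected_graph E"
    and "genus (eigenset E (minimax_value E 2)) = 1"
  shows "(\<forall>\<phi>\<in>eigenset E (minimax_value E 2). nodal_count E \<phi> \<le> 2) \<and>
         max_nodal_count E (minimax_value E 2) \<le> 2"
proof -
  let ?K = "eigenset E (minimax_value E 2)"
  have le: "nodal_count E \<phi> \<le> 2" if "\<phi> \<in> ?K" for \<phi>
    using nodal_count_le_2[OF assms(1,2,4) _ that] assms(5) by simp
  \<comment> \<open>The \<open>Max\<close> in \<open>max_nodal_count\<close> needs a nonempty finite
    set: genus 1 excludes the empty eigenset, and the counts are bounded by 2.\<close>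
  have "?K \<noteq> {}"
  proof
    assume "?K = {}"
    with assms(5) show False by (simp add: genus_empty)
  qed
  moreover have "finite (nodal_count E ` ?K)"
    by (rule finite_subset[of _ "{..2}"]) (auto intro: le)
  ultimately have "max_nodal_count E (minimax_value E 2) \<le> 2"
    unfolding max_nodal_count_def using le by simp
  with le show ?thesis by blast
qed

end
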